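(* Let $\Gamma$ be a finite simple graph with a Godsil--McKay partition $\pi=\{C_1,\dots,C_t,D\}$ with Godsil--McKay cell $D$, and let $\Delta$ be a finite simple graph. For $w\in V(\Delta)$ set $C_i^{(w)}=C_i\times\{w\}$, set $\mathcal{D}=D\times V(\Delta)$, and let $\Pi=\{C_i^{(w)}\mid i\in[t],\ w\in V(\Delta)\}\sqcup\{\mathcal{D}\}$. Then, for the product $\star$ of any type $[0s_{01}s_{02};s_{10}s_{11}s_{12};s_{20}s_{21}s_{22}]$ with $s_{ij}\in\{0,1\}$, $\Pi$ is a Godsil--McKay partition of $\Gamma\star\Delta$ with Godsil--McKay cell $\mathcal{D}$. Moreover, $(\mathrm{sw}_{\pi}\Gamma)\star\Delta$ is isomorphic to $\mathrm{sw}_{\Pi}(\Gamma\star\Delta)$.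
   Context: A partition $\{C_1,\dots,C_t\}$ of a vertex set is equitable if for all $i,j$ any two vertices of $C_i$ have the same number of neighbours in $C_j$. A partition $\pi=\{C_1,\dots,C_t,D\}$ of $V(\Gamma)$ is a Godsil--McKay partition with Godsil--McKay cell $D$ if (i) $\{C_1,\dots,C_t\}$ is an equitable partition of the induced subgraph on $V(\Gamma)\setminus D$, and (ii) for every $x\in D$ and every $i\in[t]$, $x$ has either $0$, $\tfrac12|C_i|$ or $|C_i|$ neighbours in $C_i$. The switched graph $\mathrm{sw}_\pi\Gamma$ (Godsil--McKay switching) is obtained from $\Gamma$ by interchanging adjacency and nonadjacency between $x\in D$ and the vertices of $C_i$ whenever $x$ has exactly $\tfrac12|C_i|$ neighbours in $C_i$. Graph products of a given type: for graphs $\Gamma,\Delta$ set $A_0=I_{|V(\Gamma)|}$, $A_1=A(\Gamma)$, $A_2=J-I-A(\Gamma)$, $B_0=I_{|V(\Delta)|}$, $B_1=A(\Delta)$, $B_2=J-I-A(\Delta)$, where $A(\cdot)$ is the adjacency matrix, $J$ the all-ones matrix and $I$ the identity. Given $s_{ij}\in\{0,1\}$ with $s_{00}=0$, $\Gamma\star\Delta$ is the simple graph on $V(\Gamma)\times V(\Delta)$ with adjacency matrix $\sum_{i,j\in\{0,1,2\}}s_{ij}(A_i\otimes B_j)$; the sequence $[0s_{01}s_{02};s_{10}s_{11}s_{12};s_{20}s_{21}s_{22}]$ is its type. *)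

theory Defs
  imports "Graph_Theory.Graph_Theory" "HOL-Library.Disjoint_Sets"
begin

text \<open>
  Finite simple graphs are the symmetric loop-free finite digraphs \<open>pair_graph\<close>: an edge
  \<open>uv\<close> is represented by the two arcs \<open>(u, v)\<close> and \<open>(v, u)\<close>. A partition
  \<open>{C\<^sub>1, \<dots>, C\<^sub>t, D}\<close> with distinguished cell \<open>D\<close> is given by the set
  \<open>\<C> = {C\<^sub>1, \<dots>, C\<^sub>t}\<close> together with \<open>D\<close>.
\<close>

definition num_nbrs :: "('a, 'b) pre_digraph \<Rightarrow> 'a \<Rightarrow> 'a set \<Rightarrow> nat" where
  "num_nbrs G x S = card {y \<in> S. x \<rightarrow>\<^bsub>G\<^esub> y}"

definition equitable_partition :: "('a, 'b) pre_digraph \<Rightarrow> 'a set set \<Rightarrow> bool" where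
  "equitable_partition G \<C> \<longleftrightarrow>
     partition_on (verts G) \<C> \<and>
     (\<forall>C\<in>\<C>. \<forall>C'\<in>\<C>. \<forall>u\<in>C. \<forall>v\<in>C. num_nbrs G u C' = num_nbrs G v C')"

text \<open>
  The cells in \<open>\<C>\<close> are nonempty by \<open>partition_on\<close>; the cell \<open>D\<close> is allowed to be empty.
\<close>

definition gm_partition :: "'a pair_pre_digraph \<Rightarrow> 'a set set \<Rightarrow> 'a set \<Rightarrow> bool" where
  "gm_partition G \<C> D \<longleftrightarrow>
     D \<subseteq> pverts G \<and>
     equitable_partition (with_proj G \<restriction> (pverts G - D)) \<C> \<and>
     (\<forall>x\<in>D. \<forall>C\<in>\<C>. num_nbrs G x C = 0 \<or> 2 * num_nbrs G x C = card C \<or> num_nbrs G x C = card C)"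

definition gm_flipped :: "'a pair_pre_digraph \<Rightarrow> 'a set set \<Rightarrow> 'a set \<Rightarrow> 'a \<Rightarrow> 'a \<Rightarrow> bool" where
  "gm_flipped G \<C> D x v \<longleftrightarrow> x \<in> D \<and> (\<exists>C\<in>\<C>. v \<in> C \<and> 2 * num_nbrs G x C = card C)"

definition gm_switch :: "'a pair_pre_digraph \<Rightarrow> 'a set set \<Rightarrow> 'a set \<Rightarrow> 'a pair_pre_digraph" where
  "gm_switch G \<C> D =
     \<lparr> pverts = pverts G,
       parcs = {(u, v) \<in> pverts G \<times> pverts G.
         if gm_flipped G \<C> D u v \<or> gm_flipped G \<C> D v u
         then (u, v) \<notin> parcs G else (u, v) \<in> parcs G} \<rparr>"

text \<open>
  Matrices are indexed by vertices. \<open>rel_mat G\<close> maps \<open>0, 1, 2\<close> to \<open>I\<close>, \<open>A(G)\<close>, \<open>J - I - A(G)\<close>.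
\<close>

definition adj_mat :: "'a pair_pre_digraph \<Rightarrow> 'a \<Rightarrow> 'a \<Rightarrow> int" where
  "adj_mat G u v = of_bool ((u, v) \<in> parcs G)"

definition id_mat :: "'a \<Rightarrow> 'a \<Rightarrow> int" where
  "id_mat u v = of_bool (u = v)"

definition rel_mat :: "'a pair_pre_digraph \<Rightarrow> nat \<Rightarrow> 'a \<Rightarrow> 'a \<Rightarrow> int" where
  "rel_mat G i u v =
     (if i = 0 then id_mat u v
      else if i = 1 then adj_mat G u v
      else 1 - id_mat u v - adj_mat G u v)"

definition kronecker ::
    "('a \<Rightarrow> 'a \<Rightarrow> int) \<Rightarrow> ('b \<Rightarrow> 'b \<Rightarrow> int) \<Rightarrow> 'a \<times> 'b \<Rightarrow> 'a \<times> 'b \<Rightarrow> int" where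
  "kronecker A B x y = A (fst x) (fst y) * B (snd x) (snd y)"

definition prod_mat :: "(nat \<Rightarrow> nat \<Rightarrow> int) \<Rightarrow> 'a pair_pre_digraph \<Rightarrow> 'b pair_pre_digraph \<Rightarrow>
    'a \<times> 'b \<Rightarrow> 'a \<times> 'b \<Rightarrow> int" where
  "prod_mat s G H x y =
     (\<Sum>i\<in>{0,1,2}. \<Sum>j\<in>{0,1,2}. s i j * kronecker (rel_mat G i) (rel_mat H j) x y)"

definition product_type :: "(nat \<Rightarrow> nat \<Rightarrow> int) \<Rightarrow> bool" where
  "product_type s \<longleftrightarrow> s 0 0 = 0 \<and> (\<forall>i\<in>{0,1,2}. \<forall>j\<in>{0,1,2}. s i j \<in> {0, 1})"

definition graph_prod :: "(nat \<Rightarrow> nat \<Rightarrow> int) \<Rightarrow> 'a pair_pre_digraph \<Rightarrow> 'b pair_pre_digraph \<Rightarrow>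
    ('a \<times> 'b) pair_pre_digraph" where
  "graph_prod s G H =
     \<lparr> pverts = pverts G \<times> pverts H,
       parcs = {(x, y). x \<in> pverts G \<times> pverts H \<and> y \<in> pverts G \<times> pverts H \<and>
                        prod_mat s G H x y = 1} \<rparr>"

lemma pair_graph_arc_sym:
  assumes "pair_graph G"
  shows "(u, v) \<in> parcs G \<longleftrightarrow> (v, u) \<in> parcs G"
proof -
  interpret pair_graph G by fact
  show ?thesis using pair_sym_arcs by (auto simp: symmetric_def dest: symD)
qed

lemma pair_graph_irrefl:
  assumes "pair_graph G"
  shows "(u, u) \<notin> parcs G"
proof -
  interpret pair_graph G by fact
  show ?thesis using pair_no_loops by fastforce
qed

lemma pair_graphI:
  assumes "finite (pverts G)" "parcs G \<subseteq> pverts G \<times> pverts G"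
    "\<And>u v. (u, v) \<in> parcs G \<Longrightarrow> (v, u) \<in> parcs G" "\<And>u. (u, u) \<notin> parcs G"
  shows "pair_graph G"
proof
  show "finite (parcs G)"
    using assms(1,2) by (meson finite_SigmaI finite_subset)
  show "symmetric (with_proj G)"
    using assms(3) by (auto simp: symmetric_def intro: symI)
qed (use assms in auto)

lemma prod_mat_01:
  assumes "pair_graph G" "pair_graph H" "product_type s"
  shows "prod_mat s G H x y \<in> {0, 1}"
  using assms pair_graph_irrefl[OF assms(1)] pair_graph_irrefl[OF assms(2)]
  by (auto simp: prod_mat_def kronecker_def rel_mat_def id_mat_def adj_mat_def product_type_def
      split: if_splits)

lemma pverts_graph_prod: "pverts (graph_prod s G H) = pverts G \<times> pverts H"
  by (simp add: graph_prod_def)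

text \<open>The adjacency matrix of the product is \<open>\<Sum>\<^sub>i\<^sub>j s\<^sub>i\<^sub>j (A\<^sub>i \<otimes> B\<^sub>j)\<close>.\<close>

lemma adj_mat_graph_prod:
  assumes "pair_graph G" "pair_graph H" "product_type s"
    and "x \<in> pverts G \<times> pverts H" "y \<in> pverts G \<times> pverts H"
  shows "adj_mat (graph_prod s G H) x y = prod_mat s G H x y"
  using prod_mat_01[OF assms(1-3), of x y] assms(4,5)
  by (auto simp: adj_mat_def graph_prod_def)

lemma pair_graph_graph_prod:
  assumes "pair_graph G" "pair_graph H" "product_type s"
  shows "pair_graph (graph_prod s G H)"
proof (rule pair_graphI)
  have fin: "finite (pverts G)" "finite (pverts H)"
    using assms(1,2) by (auto dest!: pair_graph.axioms(1) pair_digraph.axioms(1)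
        pair_fin_digraph.pair_finite_verts)
  then show "finite (pverts (graph_prod s G H))"
    by (simp add: graph_prod_def)
  show "parcs (graph_prod s G H) \<subseteq> pverts (graph_prod s G H) \<times> pverts (graph_prod s G H)"
    by (auto simp: graph_prod_def)
  have rel: "rel_mat G i u v = rel_mat G i v u" "rel_mat H i u' v' = rel_mat H i v' u'"
    for i u v u' v'
    using pair_graph_arc_sym[OF assms(1), of u v] pair_graph_arc_sym[OF assms(2), of u' v']
    by (auto simp: rel_mat_def id_mat_def adj_mat_def)
  have "prod_mat s G H x y = prod_mat s G H y x" for x y
    unfolding prod_mat_def kronecker_def
    by (subst rel(1), subst rel(2)) (rule refl)
  then show "(x, y) \<in> parcs (graph_prod s G H) \<Longrightarrow> (y, x) \<in> parcs (graph_prod s G H)" for x y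
    by (auto simp: graph_prod_def)
  show "(x, x) \<notin> parcs (graph_prod s G H)" for x
    using assms(3) pair_graph_irrefl[OF assms(1)] pair_graph_irrefl[OF assms(2)]
    by (auto simp: graph_prod_def prod_mat_def kronecker_def rel_mat_def id_mat_def adj_mat_def
        product_type_def)
qed

lemma pair_graph_gm_switch:
  assumes "pair_graph G" "gm_partition G \<C> D"
  shows "pair_graph (gm_switch G \<C> D)"
proof (rule pair_graphI)
  show "finite (pverts (gm_switch G \<C> D))"
    using assms(1) by (auto simp: gm_switch_def dest!: pair_graph.axioms(1) pair_digraph.axioms(1)
        pair_fin_digraph.pair_finite_verts)
  show "parcs (gm_switch G \<C> D) \<subseteq> pverts (gm_switch G \<C> D) \<times> pverts (gm_switch G \<C> D)"
    by (auto simp: gm_switch_def)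
  show "(u, v) \<in> parcs (gm_switch G \<C> D) \<Longrightarrow> (v, u) \<in> parcs (gm_switch G \<C> D)" for u v
    using pair_graph_arc_sym[OF assms(1), of u v] by (auto simp: gm_switch_def split: if_splits)
  have "\<Union>\<C> = pverts G - D"
    using assms(2) by (simp add: gm_partition_def equitable_partition_def partition_on_def)
  then have "\<not> gm_flipped G \<C> D u u" for u
    by (auto simp: gm_flipped_def)
  then show "(u, u) \<notin> parcs (gm_switch G \<C> D)" for u
    using pair_graph_irrefl[OF assms(1)] by (auto simp: gm_switch_def)
qed

end

theory Submission
  imports Defs
begin

text \<open>
  Two vertices of a graph are equal, adjacent or distinct and non-adjacent, and the adjacency of
  \<open>(u, w)\<close> and \<open>(v, w')\<close> in a product depends only on these relations for \<open>u, v\<close> and \<open>w, w'\<close>.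
  Fix \<open>w, w'\<close> and let \<open>k\<close> be their relation. If \<open>u \<in> V(\<Gamma>)\<close> has \<open>n\<close> neighbours in a cell \<open>C\<close>, then
  \<open>(u, w)\<close> has \<open>s\<^sub>0\<^sub>k [u \<in> C] + s\<^sub>1\<^sub>k n + s\<^sub>2\<^sub>k (|C| - [u \<in> C] - n)\<close> neighbours in \<open>C \<times> {w'}\<close>, so
  equitability is inherited. For \<open>x \<in> D\<close> the count is \<open>0\<close>, \<open>n\<close>, \<open>|C| - n\<close> or \<open>|C|\<close>; it is half of
  \<open>|C|\<close> exactly if \<open>n\<close> is and \<open>s\<^sub>1\<^sub>k \<noteq> s\<^sub>2\<^sub>k\<close>. If \<open>s\<^sub>1\<^sub>k = s\<^sub>2\<^sub>k\<close>, interchanging adjacency and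
  nonadjacency in \<open>\<Gamma>\<close> does not affect the product, and otherwise it flips the product edge. Hence
  switching commutes with the product, and the required isomorphism is the identity.
\<close>

section \<open>Adjacency in the product through pair relations\<close>

definition rel_index :: "'a pair_pre_digraph \<Rightarrow> 'a \<Rightarrow> 'a \<Rightarrow> nat" where
  "rel_index G u v = (if u = v then 0 else if (u, v) \<in> parcs G then 1 else 2)"

lemma rel_index_in: "rel_index G u v \<in> {0, 1, 2}"
  by (simp add: rel_index_def)

lemma rel_mat_eq_of_bool:
  assumes "pair_graph G" "i \<in> {0, 1, 2}"
  shows "rel_mat G i u v = of_bool (i = rel_index G u v)"
  using assms(2) pair_graph_irrefl[OF assms(1)]
  by (auto simp: rel_mat_def rel_index_def id_mat_def adj_mat_def)

text \<open>The matrices \<open>I\<close>, \<open>A\<close>, \<open>J - I - A\<close> of a loop-free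
  graph are 0/1 matrices with sum \<open>J\<close>, so exactly one of the nine Kronecker products
  has a nonzero entry at a given position.\<close>

lemma prod_mat_eq:
  assumes "pair_graph G" "pair_graph H"
  shows "prod_mat s G H (u, w) (v, w') = s (rel_index G u v) (rel_index H w w')"
proof -
  define a where "a = rel_index G u v"
  define b where "b = rel_index H w w'"
  have ab: "a \<in> {0, 1, 2}" "b \<in> {0, 1, 2}"
    by (simp_all only: a_def b_def rel_index_in)
  have "prod_mat s G H (u, w) (v, w') =
      (\<Sum>i\<in>{0,1,2}. \<Sum>j\<in>{0,1,2}. if i = a then if j = b then s i j else 0 else 0)"
    unfolding prod_mat_def kronecker_def
    by (intro sum.cong refl)
      (simp add: rel_mat_eq_of_bool[OF assms(1)] rel_mat_eq_of_bool[OF assms(2)] a_def b_def)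
  also have "\<dots> = s a b"
    using ab by auto
  finally show ?thesis
    by (simp only: a_def b_def)
qed

lemma parcs_graph_prod_iff:
  assumes "pair_graph G" "pair_graph H"
  shows "((u, w), (v, w')) \<in> parcs (graph_prod s G H) \<longleftrightarrow>
    u \<in> pverts G \<and> v \<in> pverts G \<and> w \<in> pverts H \<and> w' \<in> pverts H \<and>
    s (rel_index G u v) (rel_index H w w') = 1"
  by (auto simp: graph_prod_def prod_mat_eq[OF assms])

section \<open>Neighbour counts\<close>

lemma num_nbrs_with_proj: "num_nbrs (with_proj G) x S = card {y \<in> S. (x, y) \<in> parcs G}"
  by (simp add: num_nbrs_def arcs_ends_def arc_to_ends_def)

text \<open>Equitability refers to the graph without the switching cell; this lets the counts be
  taken in the whole graph.\<close>

lemma num_nbrs_induce_subgraph: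
  assumes "u \<in> S" "C \<subseteq> S"
  shows "num_nbrs (with_proj G \<restriction> S) u C = num_nbrs (with_proj G) u C"
proof -
  have "{y \<in> C. u \<rightarrow>\<^bsub>with_proj G \<restriction> S\<^esub> y} = {y \<in> C. u \<rightarrow>\<^bsub>with_proj G\<^esub> y}"
    using assms by (auto simp: arcs_ends_def arc_to_ends_def induce_subgraph_def image_iff)
  then show ?thesis
    by (simp add: num_nbrs_def)
qed

text \<open>\<open>C\<close> splits into \<open>u\<close> (if present), its neighbours and the
  remaining vertices. The relation to \<open>u\<close> is constant on each block, so each block is
  counted entirely or not at all. The natural-number subtraction is exact, the removed blocks being
  disjoint subsets of \<open>C\<close>.\<close>

lemma num_nbrs_graph_prod:
  assumes "pair_graph G" "pair_graph H" "finite C" "C \<subseteq> pverts G" "u \<in> pverts G"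
    "w \<in> pverts H" "w' \<in> pverts H"
  defines "k \<equiv> rel_index H w w'"
  shows "num_nbrs (with_proj (graph_prod s G H)) (u, w) (C \<times> {w'}) =
    of_bool (s 0 k = 1) * of_bool (u \<in> C) +
    of_bool (s 1 k = 1) * num_nbrs (with_proj G) u C +
    of_bool (s 2 k = 1) * (card C - of_bool (u \<in> C) - num_nbrs (with_proj G) u C)"
proof -
  define N0 where "N0 = C \<inter> {u}"
  define N1 where "N1 = {v \<in> C. (u, v) \<in> parcs G}"
  have fin: "finite N0" "finite N1"
    using \<open>finite C\<close> by (auto simp: N0_def N1_def)
  have disj: "N0 \<inter> N1 = {}"
    using pair_graph_irrefl[OF assms(1)] by (auto simp: N0_def N1_def)
  have card0: "card N0 = of_bool (u \<in> C)"
    by (simp add: N0_def)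
  have card2: "card (C - N0 - N1) = card C - card N0 - card N1"
  proof -
    have "card (C - N0 - N1) = card (C - N0) - card N1"
      using fin disj by (intro card_Diff_subset) (auto simp: N0_def N1_def)
    also have "card (C - N0) = card C - card N0"
      using fin by (intro card_Diff_subset) (auto simp: N0_def)
    finally show ?thesis .
  qed
  have "{y \<in> C \<times> {w'}. ((u, w), y) \<in> parcs (graph_prod s G H)} =
      {v \<in> C. s (rel_index G u v) k = 1} \<times> {w'}"
    using assms by (auto simp: parcs_graph_prod_iff)
  moreover have "{v \<in> C. s (rel_index G u v) k = 1} =
      (if s 0 k = 1 then N0 else {}) \<union> (if s 1 k = 1 then N1 else {}) \<union>
      (if s 2 k = 1 then C - N0 - N1 else {})"
    using pair_graph_irrefl[OF assms(1)]
    by (auto simp: N0_def N1_def rel_index_def split: if_splits)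
  moreover have "card \<dots> = of_bool (s 0 k = 1) * card N0 + of_bool (s 1 k = 1) * card N1 +
      of_bool (s 2 k = 1) * card (C - N0 - N1)"
    using fin \<open>finite C\<close> disj by (subst card_Un_disjoint; auto)+
  ultimately show ?thesis
    by (simp add: num_nbrs_with_proj card_cartesian_product card2 card0 flip: N1_def)
qed

section \<open>The Godsil-McKay partition of the product\<close>

lemma partition_on_Times_singletons:
  assumes "partition_on A \<C>"
  shows "partition_on (A \<times> B) {C \<times> {w} | C w. C \<in> \<C> \<and> w \<in> B}"
proof (rule partition_onI)
  show "\<Union>{C \<times> {w} | C w. C \<in> \<C> \<and> w \<in> B} = A \<times> B"
    using partition_onD1[OF assms] by auto
  show "{} \<notin> {C \<times> {w} | C w. C \<in> \<C> \<and> w \<in> B}"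
    using partition_onD3[OF assms] by (auto simp: eq_commute[of "{}"])
  show "disjnt p p'" if cells: "p \<in> {C \<times> {w} | C w. C \<in> \<C> \<and> w \<in> B}"
    "p' \<in> {C \<times> {w} | C w. C \<in> \<C> \<and> w \<in> B}" "p \<noteq> p'" for p p'
  proof -
    obtain C w C' w' where *: "p = C \<times> {w}" "p' = C' \<times> {w'}" "C \<in> \<C>" "C' \<in> \<C>"
      using cells(1,2) by auto
    then have "C \<noteq> C' \<or> w \<noteq> w'"
      using \<open>p \<noteq> p'\<close> by auto
    then show ?thesis
      using * partition_onD2[OF assms] by (auto simp: disjnt_def disjoint_def)
  qed
qed

locale gm_graph =
  fixes G :: "'a pair_pre_digraph" and \<C> :: "'a set set" and D :: "'a set"
  assumes graph: "pair_graph G" and gm: "gm_partition G \<C> D"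
begin

lemma partition_cells: "partition_on (pverts G - D) \<C>"
  using gm by (simp add: gm_partition_def equitable_partition_def)

lemma D_subset: "D \<subseteq> pverts G"
  using gm by (simp add: gm_partition_def)

lemma finite_pverts: "finite (pverts G)"
  using graph by (auto dest!: pair_graph.axioms(1) pair_digraph.axioms(1)
      pair_fin_digraph.pair_finite_verts)

lemma cell_subset: "C \<in> \<C> \<Longrightarrow> C \<subseteq> pverts G - D"
  using partition_onD1[OF partition_cells] by blast

lemma finite_cell: "C \<in> \<C> \<Longrightarrow> finite C"
  using cell_subset finite_pverts by (meson finite_Diff finite_subset)

text \<open>Keeps the counts \<open>0\<close>, \<open>|C|/2\<close> and \<open>|C|\<close> distinct;
  for an empty cell all three would coincide.\<close>

lemma card_cell_pos: "C \<in> \<C> \<Longrightarrow> 0 < card C"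
  using finite_cell partition_onD3[OF partition_cells] by (metis card_gt_0_iff)

lemma cell_unique: "C \<in> \<C> \<Longrightarrow> C' \<in> \<C> \<Longrightarrow> v \<in> C \<Longrightarrow> v \<in> C' \<Longrightarrow> C = C'"
  using partition_onD2[OF partition_cells] by (auto simp: disjoint_def)

lemma num_nbrs_cell_eq:
  assumes "C \<in> \<C>" "C' \<in> \<C>" "u \<in> C" "v \<in> C"
  shows "num_nbrs (with_proj G) u C' = num_nbrs (with_proj G) v C'"
proof -
  have "num_nbrs (with_proj G \<restriction> (pverts G - D)) u C' =
      num_nbrs (with_proj G \<restriction> (pverts G - D)) v C'"
    using gm assms unfolding gm_partition_def equitable_partition_def by blast
  then show ?thesis
    using assms cell_subset[of C] cell_subset[of C']
    by (simp add: num_nbrs_induce_subgraph subset_iff)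
qed

lemma num_nbrs_gm_cell:
  assumes "x \<in> D" "C \<in> \<C>"
  shows "num_nbrs (with_proj G) x C = 0 \<or> 2 * num_nbrs (with_proj G) x C = card C \<or>
    num_nbrs (with_proj G) x C = card C"
  using gm assms unfolding gm_partition_def by blast

lemma gm_partition_graph_prod:
  assumes "pair_graph H"
  shows "gm_partition (graph_prod s G H) {C \<times> {w} | C w. C \<in> \<C> \<and> w \<in> pverts H} (D \<times> pverts H)"
    (is "gm_partition ?P ?\<C> ?D")
  unfolding gm_partition_def
proof (intro conjI ballI)
  show "?D \<subseteq> pverts ?P"
    using D_subset by (auto simp: pverts_graph_prod)
  have verts: "pverts ?P - ?D = (pverts G - D) \<times> pverts H"
    by (auto simp: pverts_graph_prod)
  show "equitable_partition (with_proj ?P \<restriction> (pverts ?P - ?D)) ?\<C>"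
    unfolding equitable_partition_def
  proof (intro conjI ballI)
    show "partition_on (verts (with_proj ?P \<restriction> (pverts ?P - ?D))) ?\<C>"
      using partition_on_Times_singletons[OF partition_cells] by (simp add: verts)
  next
    fix K K' x y assume K: "K \<in> ?\<C>" "K' \<in> ?\<C>" and xy: "x \<in> K" "y \<in> K"
    obtain C w where C: "K = C \<times> {w}" "C \<in> \<C>" "w \<in> pverts H"
      using K(1) by blast
    obtain C' w' where C': "K' = C' \<times> {w'}" "C' \<in> \<C>" "w' \<in> pverts H"
      using K(2) by blast
    obtain u v where uv: "x = (u, w)" "y = (v, w)" "u \<in> C" "v \<in> C"
      using xy C(1) by auto
    \<comment> \<open>Cells are disjoint, so the diagonal term of the count agrees for
      \<open>u\<close> and \<open>v\<close>; equitability in \<open>G\<close> settles the other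
      terms.\<close>
    have "u \<in> C' \<longleftrightarrow> v \<in> C'"
      using cell_unique C(2) C'(2) uv by blast
    then have "num_nbrs (with_proj ?P) x K' = num_nbrs (with_proj ?P) y K'"
      using uv C C' cell_subset[of C] cell_subset[of C'] finite_cell[of C']
        num_nbrs_cell_eq[of C C' u v]
      by (simp add: num_nbrs_graph_prod[OF graph assms] subset_iff)
    moreover have "x \<in> pverts ?P - ?D" "y \<in> pverts ?P - ?D" "K' \<subseteq> pverts ?P - ?D"
      using uv C C' cell_subset[of C] cell_subset[of C'] unfolding verts by auto
    ultimately show "num_nbrs (with_proj ?P \<restriction> (pverts ?P - ?D)) x K' =
        num_nbrs (with_proj ?P \<restriction> (pverts ?P - ?D)) y K'"
      by (simp only: num_nbrs_induce_subgraph)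
  qed
next
  \<comment> \<open>As \<open>u\<close> lies outside \<open>C\<close>, the diagonal term vanishes;
    passing from \<open>n\<close> to \<open>|C| - n\<close> preserves the set of admissible counts
    \<open>0\<close>, \<open>|C|/2\<close>, \<open>|C|\<close>.\<close>
  fix x K assume "x \<in> ?D" "K \<in> ?\<C>"
  then obtain u w C w' where *: "x = (u, w)" "u \<in> D" "w \<in> pverts H"
    "K = C \<times> {w'}" "C \<in> \<C>" "w' \<in> pverts H"
    by auto
  then have "u \<notin> C" "C \<subseteq> pverts G" "u \<in> pverts G"
    using cell_subset D_subset by auto
  then show "num_nbrs (with_proj ?P) x K = 0 \<or> 2 * num_nbrs (with_proj ?P) x K = card K \<or>
      num_nbrs (with_proj ?P) x K = card K"
    using * num_nbrs_gm_cell[of u C] finite_cell[of C]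
    by (auto simp: num_nbrs_graph_prod[OF graph assms] card_cartesian_product)
qed

section \<open>Switching commutes with the product\<close>

lemma gm_flipped_graph_prod_iff:
  assumes "pair_graph H" "w \<in> pverts H" "w' \<in> pverts H"
  shows "gm_flipped (graph_prod s G H) {C \<times> {w} | C w. C \<in> \<C> \<and> w \<in> pverts H} (D \<times> pverts H)
      (x, w) (v, w') \<longleftrightarrow>
    gm_flipped G \<C> D x v \<and> (s 1 (rel_index H w w') = 1 \<longleftrightarrow> s 2 (rel_index H w w') \<noteq> 1)"
    (is "gm_flipped ?P ?\<C> ?D _ _ \<longleftrightarrow> _ \<and> ?one")
proof -
  \<comment> \<open>\<open>?one\<close> says that exactly one of \<open>s 1 k\<close>,
    \<open>s 2 k\<close> is 1, where \<open>k\<close> is the relation of \<open>w\<close> and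
    \<open>w'\<close>. Then the count is \<open>n\<close> or \<open>|C| - n\<close>, and either is
    half of \<open>|C|\<close> iff \<open>n\<close> is. Otherwise the count is \<open>0\<close> or
    \<open>|C|\<close>, never half since \<open>|C| > 0\<close>.\<close>
  have half: "2 * num_nbrs (with_proj ?P) (x, w) (C \<times> {w'}) = card (C \<times> {w'}) \<longleftrightarrow>
      2 * num_nbrs (with_proj G) x C = card C \<and> ?one" if "x \<in> D" "C \<in> \<C>" for C
  proof -
    have "x \<notin> C" "C \<subseteq> pverts G" "x \<in> pverts G"
      using that cell_subset D_subset by auto
    moreover have "C \<noteq> {}"
      using card_cell_pos that(2) by force
    ultimately show ?thesis
      using that assms(2,3) num_nbrs_gm_cell[of x C] finite_cell[of C] card_cell_pos[of C]
      by (cases "s 1 (rel_index H w w') = 1"; cases "s 2 (rel_index H w w') = 1")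
        (simp_all add: num_nbrs_graph_prod[OF graph assms(1)] card_cartesian_product, linarith)
  qed
  \<comment> \<open>A product cell containing \<open>(v, w')\<close> must lie in the layer over
    \<open>w'\<close>.\<close>
  have ex: "(\<exists>K\<in>?\<C>. (v, w') \<in> K \<and> Q K) \<longleftrightarrow> (\<exists>C\<in>\<C>. v \<in> C \<and> Q (C \<times> {w'}))" for Q
    using assms(3) by auto
  have "gm_flipped ?P ?\<C> ?D (x, w) (v, w') \<longleftrightarrow>
      x \<in> D \<and> (\<exists>C\<in>\<C>. v \<in> C \<and> 2 * num_nbrs (with_proj ?P) (x, w) (C \<times> {w'}) = card (C \<times> {w'}))"
    by (simp only: gm_flipped_def ex mem_Times_iff fst_conv snd_conv assms(2) simp_thms)
  also have "\<dots> \<longleftrightarrow> x \<in> D \<and> (\<exists>C\<in>\<C>. v \<in> C \<and> 2 * num_nbrs (with_proj G) x C = card C \<and> ?one)"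
    using half by (intro conj_cong bex_cong refl) auto
  also have "\<dots> \<longleftrightarrow> gm_flipped G \<C> D x v \<and> ?one"
    unfolding gm_flipped_def by blast
  finally show ?thesis .
qed

lemma gm_flipped_neq: "gm_flipped G \<C> D x v \<Longrightarrow> x \<noteq> v"
  using cell_subset by (auto simp: gm_flipped_def)

text \<open>\<open>3 - i\<close> swaps adjacency (1) and nonadjacency (2); the two ends of a flipped
  pair are distinct, so index 0 does not arise there.\<close>

lemma rel_index_gm_switch:
  assumes "u \<in> pverts G" "v \<in> pverts G"
  shows "rel_index (gm_switch G \<C> D) u v =
    (if gm_flipped G \<C> D u v \<or> gm_flipped G \<C> D v u then 3 - rel_index G u v else rel_index G u v)"
  using assms gm_flipped_neq[of u v] gm_flipped_neq[of v u]
  by (auto simp: rel_index_def gm_switch_def)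

lemma graph_prod_gm_switch:
  assumes H: "pair_graph H"
  shows "graph_prod s (gm_switch G \<C> D) H =
    gm_switch (graph_prod s G H) {C \<times> {w} | C w. C \<in> \<C> \<and> w \<in> pverts H} (D \<times> pverts H)"
    (is "?L = gm_switch ?P ?\<C> ?D")
proof -
  have sw: "pair_graph (gm_switch G \<C> D)"
    using pair_graph_gm_switch[OF graph gm] .
  have verts: "pverts (gm_switch G \<C> D) = pverts G"
    by (simp add: gm_switch_def)
  have "((u, w), (v, w')) \<in> parcs ?L \<longleftrightarrow> ((u, w), (v, w')) \<in> parcs (gm_switch ?P ?\<C> ?D)"
    for u w v w'
  proof (cases "u \<in> pverts G \<and> v \<in> pverts G \<and> w \<in> pverts H \<and> w' \<in> pverts H")
    case False
    then show ?thesis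
      by (auto simp: graph_prod_def gm_switch_def)
  next
    case True
    define k where "k = rel_index H w w'"
    \<comment> \<open>A flip may come from either end of the pair; symmetry of the relation gives
      the same condition on \<open>s\<close> in both orientations.\<close>
    have sym: "rel_index H w' w = k"
      using pair_graph_arc_sym[OF H, of w w'] by (auto simp: k_def rel_index_def)
    define f where "f \<longleftrightarrow> gm_flipped G \<C> D u v \<or> gm_flipped G \<C> D v u"
    have flip: "gm_flipped ?P ?\<C> ?D (u, w) (v, w') \<or> gm_flipped ?P ?\<C> ?D (v, w') (u, w) \<longleftrightarrow>
        f \<and> (s 1 k = 1 \<longleftrightarrow> s 2 k \<noteq> 1)"
      using True by (auto simp: gm_flipped_graph_prod_iff[OF H] f_def sym simp flip: k_def)
    have idx: "rel_index G u v = 1 \<or> rel_index G u v = 2" if f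
      using that gm_flipped_neq by (auto simp: f_def rel_index_def)
    have "((u, w), (v, w')) \<in> parcs ?L \<longleftrightarrow> s (if f then 3 - rel_index G u v else rel_index G u v) k = 1"
      using True by (simp add: parcs_graph_prod_iff[OF sw H] verts rel_index_gm_switch f_def k_def)
    moreover have "((u, w), (v, w')) \<in> parcs (gm_switch ?P ?\<C> ?D) \<longleftrightarrow>
        (if f \<and> (s 1 k = 1 \<longleftrightarrow> s 2 k \<noteq> 1) then s (rel_index G u v) k \<noteq> 1 else s (rel_index G u v) k = 1)"
      unfolding flip[symmetric] using True
      by (simp add: gm_switch_def pverts_graph_prod parcs_graph_prod_iff[OF graph H] k_def)
    \<comment> \<open>If exactly one of \<open>s 1 k\<close>, \<open>s 2 k\<close> is 1, swapping
      the indices 1 and 2 negates the test \<open>s i k = 1\<close>; otherwise it leaves the test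
      unchanged.\<close>
    ultimately show ?thesis
      using idx by (cases f) (auto simp: numeral_eq_Suc)
  qed
  then have "parcs ?L = parcs (gm_switch ?P ?\<C> ?D)"
    by auto
  moreover have "pverts ?L = pverts (gm_switch ?P ?\<C> ?D)"
    by (simp add: graph_prod_def gm_switch_def)
  ultimately show ?thesis
    by simp
qed

end

section \<open>The isomorphism\<close>

lemma digraph_iso_refl:
  assumes "wf_digraph G"
  shows "digraph_iso G G"
proof -
  \<comment> \<open>Retaining the head and tail maps makes \<open>app_iso h G\<close> equal to
    \<open>G\<close> itself.\<close>
  define h where "h = \<lparr>iso_verts = id, iso_arcs = id, iso_head = head G, iso_tail = tail G\<rparr>"
  have "pre_digraph.digraph_isomorphism G h"
    using assms by (simp add: pre_digraph.digraph_isomorphism_def h_def)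
  moreover have "G = app_iso h G"
    by (simp add: app_iso_def h_def)
  ultimately show ?thesis
    unfolding digraph_iso_def by blast
qed

theorem theorem4p1:
  fixes \<Gamma> :: "'a pair_pre_digraph" and \<Delta> :: "'b pair_pre_digraph"
    and \<C> :: "'a set set" and D :: "'a set"
    and s :: "nat \<Rightarrow> nat \<Rightarrow> int"
  defines "\<C>' \<equiv> {C \<times> {w} | C w. C \<in> \<C> \<and> w \<in> pverts \<Delta>}"
    and "D' \<equiv> D \<times> pverts \<Delta>"
  assumes "pair_graph \<Gamma>" and "pair_graph \<Delta>"
    and "gm_partition \<Gamma> \<C> D"
    and "product_type s"
  shows "gm_partition (graph_prod s \<Gamma> \<Delta>) \<C>' D' \<and>
    digraph_iso (with_proj (graph_prod s (gm_switch \<Gamma> \<C> D) \<Delta>))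
                (with_proj (gm_switch (graph_prod s \<Gamma> \<Delta>) \<C>' D'))"
proof -
  interpret gm_graph \<Gamma> \<C> D
    using assms(3,5) by (rule gm_graph.intro)
  \<comment> \<open>The two graphs to be compared are equal, so the isomorphism is reflexivity,
    which asks for well-formedness of this graph.\<close>
  interpret L: pair_graph "graph_prod s (gm_switch \<Gamma> \<C> D) \<Delta>"
    using assms pair_graph_graph_prod pair_graph_gm_switch by blast
  show ?thesis
    using gm_partition_graph_prod[OF assms(4)] digraph_iso_refl[OF L.wf_digraph_axioms]
      graph_prod_gm_switch[OF assms(4)]
    by (simp add: \<C>'_def D'_def)
qed

end
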